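(* Let $\mathbf{w}=(a,b,c)\in\mathcal{T}_\ell\subseteq\mathbb{R}_+^3$ be a starting point. Then $$E_\alpha^{\ell}(\mathbf{w})=\nu\left(F_\alpha^{\mathrm{tr}}\left(\nu^{-1}(\mathbf{w})\right)\right),$$ i.e. $E_\alpha^\ell(\mathbf{w})(r)=\nu\big(F_\alpha^{\mathrm{tr}}(\nu^{-1}(\mathbf{w}))(r)\big)$ for all $r\in\mathbb{R}$.
   Context: $\mathbb{R}_+$ denotes the positive reals. Let $\mathcal{T}_{\mathrm{tr}}=\{(x,y,z)\in\mathbb{R}_+^3: x^2+y^2+z^2-xyz-2=-2\}$ and $\mathcal{T}_\ell=\{(a,b,c)\in\mathbb{R}_+^3:\cosh^2a+\cosh^2b+\cosh^2c=2\cosh a\cosh b\cosh c\}$; these are two models of the Teichm\"uller space of the once-punctured torus (trace coordinates $(\mathrm{tr}\,\rho(\alpha),\mathrm{tr}\,\rho(\beta),\mathrm{tr}\,\rho(\alpha\beta))$ and half-lengths of the geodesics $\alpha,\beta,\alpha\beta$), related by the homeomorphism $\nu:\mathcal{T}_{\mathrm{tr}}\to\mathcal{T}_\ell$, $\nu(x,y,z)=\left(\cosh^{-1}\tfrac x2,\cosh^{-1}\tfrac y2,\cosh^{-1}\tfrac z2\right)$. The flow $F_\alpha^{\mathrm{tr}}$ extending the left Dehn twist about $\alpha$ is, for $\mathbf{v}=(x,y,z)\in\mathcal{T}_{\mathrm{tr}}$ (where $x\ne2$), $F_\alpha^{\mathrm{tr}}(\mathbf{v})(r)=(x,y_\alpha(r),y_\alpha(r-1))$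 with $y_\alpha(r)=C_+S_+^r+C_-S_-^r$, $C_\pm=\dfrac{y(x^2-4)\pm(xy-2z)\sqrt{x^2-4}}{2(x^2-4)}$, $S_\pm=\dfrac{x\pm\sqrt{x^2-4}}{2}$. The left earthquake deformation about $\alpha$ in triangle lengths is, for $\mathbf{w}=(a,b,c)\in\mathcal{T}_\ell$, $E_\alpha^\ell(\mathbf{w})(r)=(a,b_\alpha(r),b_\alpha(r-1))$ with $b_\alpha(r)=\cosh^{-1}\left(\cosh(b)\cosh(ra)-(\cosh(c)-\cosh(a)\cosh(b))\dfrac{\sinh(ra)}{\sinh(a)}\right)$. *)

theory Defs
  imports "HOL-Analysis.Analysis"
begin

text \<open>
  Two models of the Teichmueller space of the once-punctured torus: trace coordinates
  \<open>(tr \<rho>(\<alpha>), tr \<rho>(\<beta>), tr \<rho>(\<alpha>\<beta>))\<close>, and half-lengths of the geodesics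
  \<open>\<alpha>\<close>, \<open>\<beta>\<close>, \<open>\<alpha>\<beta>\<close>.
\<close>

definition T_tr :: "(real \<times> real \<times> real) set" where
  "T_tr = {(x, y, z). x > 0 \<and> y > 0 \<and> z > 0 \<and> x\<^sup>2 + y\<^sup>2 + z\<^sup>2 - x * y * z - 2 = -2}"

definition T_len :: "(real \<times> real \<times> real) set" where
  "T_len = {(a, b, c). a > 0 \<and> b > 0 \<and> c > 0 \<and>
     (cosh a)\<^sup>2 + (cosh b)\<^sup>2 + (cosh c)\<^sup>2 = 2 * cosh a * cosh b * cosh c}"

definition nu :: "real \<times> real \<times> real \<Rightarrow> real \<times> real \<times> real" where
  "nu = (\<lambda>(x, y, z). (arcosh (x / 2), arcosh (y / 2), arcosh (z / 2)))"

definition nu_inv :: "real \<times> real \<times> real \<Rightarrow> real \<times> real \<times> real" where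
  "nu_inv = inv_into T_tr nu"

definition S_plus :: "real \<Rightarrow> real" where
  "S_plus x = (x + sqrt (x\<^sup>2 - 4)) / 2"

definition S_minus :: "real \<Rightarrow> real" where
  "S_minus x = (x - sqrt (x\<^sup>2 - 4)) / 2"

definition C_plus :: "real \<times> real \<times> real \<Rightarrow> real" where
  "C_plus = (\<lambda>(x, y, z).
     (y * (x\<^sup>2 - 4) + (x * y - 2 * z) * sqrt (x\<^sup>2 - 4)) / (2 * (x\<^sup>2 - 4)))"

definition C_minus :: "real \<times> real \<times> real \<Rightarrow> real" where
  "C_minus = (\<lambda>(x, y, z).
     (y * (x\<^sup>2 - 4) - (x * y - 2 * z) * sqrt (x\<^sup>2 - 4)) / (2 * (x\<^sup>2 - 4)))"

definition y_alpha :: "real \<times> real \<times> real \<Rightarrow> real \<Rightarrow> real" where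
  "y_alpha v r = C_plus v * S_plus (fst v) powr r + C_minus v * S_minus (fst v) powr r"

text \<open>The flow extending the left Dehn twist about \<open>\<alpha>\<close>.\<close>

definition F_alpha_tr :: "real \<times> real \<times> real \<Rightarrow> real \<Rightarrow> real \<times> real \<times> real" where
  "F_alpha_tr v r = (fst v, y_alpha v r, y_alpha v (r - 1))"

definition b_alpha :: "real \<times> real \<times> real \<Rightarrow> real \<Rightarrow> real" where
  "b_alpha = (\<lambda>(a, b, c) r.
     arcosh (cosh b * cosh (r * a) - (cosh c - cosh a * cosh b) * (sinh (r * a) / sinh a)))"

text \<open>The left earthquake deformation about \<open>\<alpha>\<close>.\<close>

definition E_alpha_len :: "real \<times> real \<times> real \<Rightarrow> real \<Rightarrow> real \<times> real \<times> real" where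
  "E_alpha_len w r = (fst w, b_alpha w r, b_alpha w (r - 1))"

text \<open>
  On \<open>T_tr\<close> all traces exceed 2, so the square roots, the real powers and the \<open>arcosh\<close>
  in \<open>nu\<close> are evaluated inside their domains; \<open>nu\<close> is a bijection from \<open>T_tr\<close> onto
  \<open>T_len\<close>, so \<open>nu_inv\<close> is its genuine inverse; and the flow stays in \<open>T_tr\<close>, so \<open>nu\<close>
  may be applied along it.
\<close>

lemma trace_gt_2:
  fixes x y z :: real
  assumes "x > 0" "y > 0" "z > 0" "x\<^sup>2 + y\<^sup>2 + z\<^sup>2 = x * y * z"
  shows "x > 2"
proof (rule ccontr)
  assume "\<not> x > 2"
  then have "x * (y * z) \<le> 2 * (y * z)"
    using assms by (intro mult_right_mono) auto
  moreover have "2 * (y * z) \<le> y\<^sup>2 + z\<^sup>2"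
    using sum_squares_bound[of y z] by simp
  moreover have "x\<^sup>2 > 0" using assms by simp
  ultimately show False using assms(4) by (simp add: mult.assoc)
qed

lemma T_tr_gt_2:
  assumes "(x, y, z) \<in> T_tr"
  shows "x > 2" "y > 2" "z > 2"
  using assms trace_gt_2[of x y z] trace_gt_2[of y x z] trace_gt_2[of z x y]
  by (auto simp: T_tr_def algebra_simps)

lemma bij_betw_nu: "bij_betw nu T_tr T_len"
proof (rule bij_betw_byWitness[where f' = "\<lambda>(a, b, c). (2 * cosh a, 2 * cosh b, 2 * cosh c)"])
  show "\<forall>v\<in>T_tr. (case nu v of (a, b, c) \<Rightarrow> (2 * cosh a, 2 * cosh b, 2 * cosh c)) = v"
  proof clarify
    fix x y z assume "(x, y, z) \<in> T_tr"
    from T_tr_gt_2[OF this]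
    show "(case nu (x, y, z) of (a, b, c) \<Rightarrow> (2 * cosh a, 2 * cosh b, 2 * cosh c)) = (x, y, z)"
      by (simp add: nu_def)
  qed
  show "\<forall>w\<in>T_len. nu (case w of (a, b, c) \<Rightarrow> (2 * cosh a, 2 * cosh b, 2 * cosh c)) = w"
    by (auto simp: nu_def T_len_def arcosh_cosh_real)
  show "nu ` T_tr \<subseteq> T_len"
  proof (rule image_subsetI, unfold split_paired_all)
    fix x y z assume v: "(x, y, z) \<in> T_tr"
    note g = T_tr_gt_2[OF v]
    have "x\<^sup>2 + y\<^sup>2 + z\<^sup>2 = x * y * z" using v by (simp add: T_tr_def)
    then show "nu (x, y, z) \<in> T_len"
      using g by (simp add: nu_def T_len_def power_divide)
  qed
  show "(\<lambda>(a, b, c). (2 * cosh a, 2 * cosh b, 2 * cosh c)) ` T_len \<subseteq> T_tr"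
    by (auto simp: T_len_def T_tr_def power_mult_distrib)
qed

lemma F_alpha_tr_in_T_tr:
  assumes v: "v \<in> T_tr"
  shows "F_alpha_tr v r \<in> T_tr"
proof -
  obtain x y z where veq: "v = (x, y, z)" by (cases v)
  note g = T_tr_gt_2[OF v[unfolded veq]]
  have eq: "x\<^sup>2 + y\<^sup>2 + z\<^sup>2 = x * y * z" using v veq by (simp add: T_tr_def)
  define s where "s = sqrt (x\<^sup>2 - 4)"
  have "x\<^sup>2 > 2\<^sup>2" using g by (intro power_strict_mono) auto
  then have s2: "s\<^sup>2 = x\<^sup>2 - 4" and s0: "s > 0" by (simp_all add: s_def)
  have "s < x"
    by (rule power2_less_imp_less) (use s2 g in linarith)+
  define P where "P = S_plus x"
  define M where "M = S_minus x"
  define Cp where "Cp = C_plus v"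
  define Cm where "Cm = C_minus v"
  have P: "P = (x + s) / 2" and M: "M = (x - s) / 2"
    by (simp_all add: P_def M_def S_plus_def S_minus_def s_def)
  have pos: "P > 0" "M > 0" using \<open>s < x\<close> s0 g by (auto simp: P M)
  have sum: "P + M = x" by (simp add: P M field_simps)
  have "4 * (P * M) = x\<^sup>2 - s\<^sup>2"
    by (simp add: P M field_simps power2_eq_square)
  then have prd: "P * M = 1" using s2 by simp
  have Cp: "Cp = (y + (x * y - 2 * z) / s) / 2" and Cm: "Cm = (y - (x * y - 2 * z) / s) / 2"
    using s0 unfolding Cp_def Cm_def C_plus_def C_minus_def veq prod.case
      s_def[symmetric] s2[symmetric]
    by (simp_all add: divide_simps power2_eq_square) (simp_all add: algebra_simps)
  have "4 * s\<^sup>2 * (Cp * Cm) = y\<^sup>2 * s\<^sup>2 - (x * y - 2 * z)\<^sup>2"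
    using s0 by (simp add: Cp Cm field_simps power2_eq_square)
  also have "\<dots> = 4 * (x * y * z - y\<^sup>2 - z\<^sup>2)"
    unfolding s2 by (simp add: algebra_simps power2_eq_square)
  finally have CC: "s\<^sup>2 * (Cp * Cm) = x\<^sup>2" using eq by simp
  then have "s\<^sup>2 * (Cp * Cm) > 0" using g by simp
  then have Cpos: "Cp * Cm > 0" using s0 by (simp add: zero_less_mult_iff)
  have "Cp + Cm = y" by (simp add: Cp Cm field_simps)
  with Cpos g have C0: "Cp > 0" "Cm > 0" by (auto simp: zero_less_mult_iff)
  define p where "p = Cp * P powr (r - 1)"
  define q where "q = Cm * M powr (r - 1)"
  have "P powr (r - 1) * M powr (r - 1) = 1"
    using pos prd by (simp flip: powr_mult)
  then have pq: "p * q = Cp * Cm"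
    by (simp add: p_def q_def mult.assoc mult.left_commute)
  have pq0: "p > 0" "q > 0" using C0 pos by (simp_all add: p_def q_def)
  have Z: "y_alpha v (r - 1) = p + q"
    by (simp add: y_alpha_def p_def q_def Cp_def Cm_def P_def M_def veq)
  have "P powr r = P powr (r - 1) * P" "M powr r = M powr (r - 1) * M"
    using pos by (simp_all add: powr_diff)
  then have Y: "y_alpha v r = p * P + q * M"
    by (simp add: y_alpha_def p_def q_def Cp_def Cm_def P_def M_def veq)
  have "(p * P + q * M)\<^sup>2 + (p + q)\<^sup>2 - x * (p * P + q * M) * (p + q)
        = (1 - P * M) * (p\<^sup>2 + q\<^sup>2) + p * q * (2 * (P * M) + 2 - x\<^sup>2)"
    unfolding sum[symmetric] by (simp add: algebra_simps power2_eq_square)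
  also have "\<dots> = - (s\<^sup>2 * (Cp * Cm))"
    unfolding prd pq s2 by (simp add: algebra_simps)
  finally have "(p * P + q * M)\<^sup>2 + (p + q)\<^sup>2 - x * (p * P + q * M) * (p + q) = - x\<^sup>2"
    using CC by simp
  then show ?thesis
    using pq0 pos g by (simp add: F_alpha_tr_def T_tr_def Y[unfolded veq] Z[unfolded veq] veq add_pos_pos)
qed

end

theory Submission
  imports Defs
begin

text \<open>
  A point of trace coordinates over the half-lengths \<open>(a, b, c)\<close> is
  \<open>(2 cosh a, 2 cosh b, 2 cosh c)\<close>. There the square root \<open>sqrt (x\<^sup>2 - 4)\<close> is \<open>2 sinh a\<close>, so
  the two characteristic roots \<open>S\<^sub>\<plusminus>\<close> of the twist recursion become the exponentials
  \<open>exp (\<plusminus> a)\<close>, and the coefficients become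
  \<open>C\<^sub>\<plusminus> = cosh b \<plusminus> (cosh a cosh b - cosh c) / sinh a\<close>. Hence \<open>C\<^sub>+ exp (r a) + C\<^sub>- exp (- r a)\<close>
  splits into its even part, a multiple of \<open>cosh (r a)\<close>, and its odd part, a multiple of
  \<open>sinh (r a)\<close>. The result is exactly twice the argument of \<open>arcosh\<close> in the earthquake
  formula (lemma \<open>y_alpha_double_cosh\<close>), and \<open>nu\<close> halves it and applies \<open>arcosh\<close>.
\<close>

text \<open>
  The witness is a trace point because its defining equation is four times that of \<open>T_len\<close>;
  the inverse value is then determined by the injectivity of \<open>nu\<close>.
\<close>

lemma nu_inv_eq_double_cosh:
  assumes "(a, b, c) \<in> T_len"
  shows "nu_inv (a, b, c) = (2 * cosh a, 2 * cosh b, 2 * cosh c)"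
proof -
  have "(2 * cosh a, 2 * cosh b, 2 * cosh c) \<in> T_tr"
    using assms by (auto simp: T_len_def T_tr_def power_mult_distrib)
  moreover have "nu (2 * cosh a, 2 * cosh b, 2 * cosh c) = (a, b, c)"
    using assms by (auto simp: T_len_def nu_def arcosh_cosh_real)
  ultimately show ?thesis
    unfolding nu_inv_def using bij_betw_imp_inj_on[OF bij_betw_nu] by (metis inv_into_f_f)
qed

lemma sqrt_double_cosh:
  fixes a :: real
  assumes "a > 0"
  shows "sqrt ((2 * cosh a)\<^sup>2 - 4) = 2 * sinh a"
proof (rule real_sqrt_unique)
  show "(2 * sinh a)\<^sup>2 = (2 * cosh a)\<^sup>2 - 4"
    by (simp add: power_mult_distrib cosh_square_eq)
qed (use assms in simp)

lemma
  fixes a :: real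
  assumes "a > 0"
  shows S_plus_double_cosh: "S_plus (2 * cosh a) = exp a"
    and S_minus_double_cosh: "S_minus (2 * cosh a) = exp (- a)"
  unfolding S_plus_def S_minus_def sqrt_double_cosh[OF assms]
  by (simp_all flip: cosh_plus_sinh cosh_minus_sinh)

lemma
  fixes a b c :: real
  assumes "a > 0"
  shows C_plus_double_cosh: "C_plus (2 * cosh a, 2 * cosh b, 2 * cosh c)
           = cosh b + (cosh a * cosh b - cosh c) / sinh a"
    and C_minus_double_cosh: "C_minus (2 * cosh a, 2 * cosh b, 2 * cosh c)
           = cosh b - (cosh a * cosh b - cosh c) / sinh a"
proof -
  have sq: "(2 * cosh a)\<^sup>2 - 4 = (2 * sinh a)\<^sup>2"
    by (simp add: power_mult_distrib cosh_square_eq)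
  have "sqrt ((2 * sinh a)\<^sup>2) = 2 * sinh a" "sinh a \<noteq> 0"
    using assms by (simp_all add: real_sqrt_unique)
  then show "C_plus (2 * cosh a, 2 * cosh b, 2 * cosh c)
           = cosh b + (cosh a * cosh b - cosh c) / sinh a"
    and "C_minus (2 * cosh a, 2 * cosh b, 2 * cosh c)
           = cosh b - (cosh a * cosh b - cosh c) / sinh a"
    unfolding C_plus_def C_minus_def prod.case sq
    by (simp_all add: field_simps power2_eq_square)
qed

text \<open>
  Splitting the two exponentials into \<open>cosh\<close> and \<open>sinh\<close>, the sum of the coefficients
  multiplies \<open>cosh (r a)\<close> and their difference multiplies \<open>sinh (r a)\<close>.
\<close>

lemma y_alpha_double_cosh:
  fixes a b c r :: real
  assumes "a > 0"
  shows "y_alpha (2 * cosh a, 2 * cosh b, 2 * cosh c) r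
       = 2 * (cosh b * cosh (r * a) - (cosh c - cosh a * cosh b) * (sinh (r * a) / sinh a))"
proof -
  have p: "exp a powr r = cosh (r * a) + sinh (r * a)"
    by (simp add: powr_def cosh_plus_sinh)
  have m: "exp (- a) powr r = cosh (r * a) - sinh (r * a)"
    by (simp add: powr_def cosh_minus_sinh)
  have "sinh a \<noteq> 0" using assms by simp
  then show ?thesis
    unfolding y_alpha_def fst_conv S_plus_double_cosh[OF assms] S_minus_double_cosh[OF assms]
      C_plus_double_cosh[OF assms] C_minus_double_cosh[OF assms] p m
    by (simp add: field_simps)
qed

theorem theorem3p2p3:
  fixes a b c :: real
  assumes "(a, b, c) \<in> T_len"
  shows "E_alpha_len (a, b, c) = (\<lambda>r. nu (F_alpha_tr (nu_inv (a, b, c)) r))"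
proof
  fix r
  have "a > 0" using assms by (simp add: T_len_def)
  note y = y_alpha_double_cosh[OF this]
  have half: "2 * t / 2 = t" for t :: real by simp
  show "E_alpha_len (a, b, c) r = nu (F_alpha_tr (nu_inv (a, b, c)) r)"
    unfolding nu_inv_eq_double_cosh[OF assms] E_alpha_len_def b_alpha_def F_alpha_tr_def nu_def
      prod.case fst_conv y half
    using \<open>a > 0\<close> by (simp add: arcosh_cosh_real)
qed

end
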